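(* Let $\Gamma$ be a tropical curve and let $f, g$ be two tropical quasi-meromorphic functions on $\Gamma$. Then \[ \sum_{x \in \Gamma} f(x)\cdot \operatorname{ord}_x g \;=\; \sum_{x\in\Gamma} g(x)\cdot \operatorname{ord}_x f . \]
   Context: A tropical curve $\Gamma$ is a connected metric graph with finitely many vertices and finitely many edges, each edge being isometric to a segment $[0,L]$ of finite length $L$. A tropical quasi-meromorphic function on $\Gamma$ is a continuous function on $\Gamma$ that is piecewise linear (with finitely many linear pieces on each edge), with arbitrary real slopes. For a point $p\in\Gamma$, the order $\operatorname{ord}_p f$ is the sum of the outgoing slopes of $f$ at $p$ over all directions emanating from $p$: if $p$ is a one-valent vertex it is the slope of $f$ in the unique direction leaving $p$; if $p$ is an interior point of an edge it is the sum of the two outgoing slopes; if $p$ is a vertex with adjacent edges $e_1,\dots,e_k$ it is $\sum_{j=1}^k \operatorname{ord}_p(f|_{e_j})$. Only finitely many points have nonzero order, so the sums are finite. *)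

theory Defs
  imports "HOL-Analysis.Analysis"
begin

text \<open>
  A metric graph is a metric space together with finitely many vertices and arc-length charts
  \<open>chart \<Gamma> e : [0, len \<Gamma> e] \<rightarrow> \<Gamma>\<close> of finitely many edges.  Loops (both ends of the chart at the
  same vertex) and multiple edges are allowed.
\<close>

record ('a, 'e) graph_model =
  gspace :: "'a metric"
  verts :: "'a set"
  edges :: "'e set"
  len :: "'e \<Rightarrow> real"
  chart :: "'e \<Rightarrow> real \<Rightarrow> 'a"

abbreviation points :: "('a, 'e, 'z) graph_model_scheme \<Rightarrow> 'a set" where
  "points \<Gamma> \<equiv> mspace (gspace \<Gamma>)"

text \<open>\<open>path_length \<Gamma> x y r\<close>: some finite path of edge segments from \<open>x\<close> to \<open>y\<close> has total length \<open>r\<close>.\<close>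

inductive path_length :: "('a, 'e, 'z) graph_model_scheme \<Rightarrow> 'a \<Rightarrow> 'a \<Rightarrow> real \<Rightarrow> bool"
  for \<Gamma> x where
  refl: "x \<in> points \<Gamma> \<Longrightarrow> path_length \<Gamma> x x 0"
| step: "\<lbrakk>path_length \<Gamma> x (chart \<Gamma> e s) r; e \<in> edges \<Gamma>;
          s \<in> {0..len \<Gamma> e}; t \<in> {0..len \<Gamma> e}\<rbrakk>
         \<Longrightarrow> path_length \<Gamma> x (chart \<Gamma> e t) (r + \<bar>t - s\<bar>)"

text \<open>
  The distance is the path metric: this is the sense in which each edge is isometric to
  \<open>[0, len \<Gamma> e]\<close> (for loops, and for edges admitting a shortcut, only the intrinsic metric of
  the edge can be meant).
\<close>

definition metric_graph :: "('a, 'e, 'z) graph_model_scheme \<Rightarrow> bool" where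
  "metric_graph \<Gamma> \<longleftrightarrow>
     finite (verts \<Gamma>) \<and> finite (edges \<Gamma>) \<and>
     (\<forall>e\<in>edges \<Gamma>. 0 < len \<Gamma> e \<and> chart \<Gamma> e 0 \<in> verts \<Gamma> \<and> chart \<Gamma> e (len \<Gamma> e) \<in> verts \<Gamma>) \<and>
     (\<forall>e\<in>edges \<Gamma>. \<forall>t\<in>{0<..<len \<Gamma> e}. chart \<Gamma> e t \<notin> verts \<Gamma>) \<and>
     inj_on (\<lambda>(e, t). chart \<Gamma> e t) (SIGMA e:edges \<Gamma>. {0<..<len \<Gamma> e}) \<and>
     points \<Gamma> = verts \<Gamma> \<union> (\<Union>e\<in>edges \<Gamma>. chart \<Gamma> e ` {0..len \<Gamma> e}) \<and>
     (\<forall>x\<in>points \<Gamma>. \<forall>y\<in>points \<Gamma>. mdist (gspace \<Gamma>) x y = Inf {r. path_length \<Gamma> x y r})"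

definition tropical_curve :: "('a, 'e, 'z) graph_model_scheme \<Rightarrow> bool" where
  "tropical_curve \<Gamma> \<longleftrightarrow> metric_graph \<Gamma> \<and> connected_space (mtopology_of (gspace \<Gamma>))"

definition piecewise_linear :: "real \<Rightarrow> (real \<Rightarrow> real) \<Rightarrow> bool" where
  "piecewise_linear L h \<longleftrightarrow>
     (\<exists>n (\<tau> :: nat \<Rightarrow> real). \<tau> 0 = 0 \<and> \<tau> n = L \<and>
        (\<forall>i<n. \<tau> i < \<tau> (Suc i) \<and>
               (\<exists>a b. \<forall>t\<in>{\<tau> i..\<tau> (Suc i)}. h t = a * t + b)))"

definition quasi_meromorphic :: "('a, 'e, 'z) graph_model_scheme \<Rightarrow> ('a \<Rightarrow> real) \<Rightarrow> bool" where
  "quasi_meromorphic \<Gamma> f \<longleftrightarrow>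
     continuous_map (mtopology_of (gspace \<Gamma>)) euclideanreal f \<and>
     (\<forall>e\<in>edges \<Gamma>. piecewise_linear (len \<Gamma> e) (\<lambda>t. f (chart \<Gamma> e t)))"

text \<open>
  A direction at \<open>p\<close> is a place \<open>(e, t)\<close> of \<open>p\<close> on an edge together with a sign \<open>\<sigma>\<close> in which
  one can move along the edge; in particular a loop contributes two directions at its vertex.
\<close>

definition directions ::
    "('a, 'e, 'z) graph_model_scheme \<Rightarrow> 'a \<Rightarrow> ('e \<times> real \<times> real) set" where
  "directions \<Gamma> p =
     {(e, t, \<sigma>). e \<in> edges \<Gamma> \<and> t \<in> {0..len \<Gamma> e} \<and> chart \<Gamma> e t = p \<and>
        (\<sigma> = 1 \<and> t < len \<Gamma> e \<or> \<sigma> = -1 \<and> 0 < t)}"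

definition outgoing_slope ::
    "('a, 'e, 'z) graph_model_scheme \<Rightarrow> ('a \<Rightarrow> real) \<Rightarrow> 'e \<times> real \<times> real \<Rightarrow> real" where
  "outgoing_slope \<Gamma> f = (\<lambda>(e, t, \<sigma>).
     Lim (at_right 0) (\<lambda>h. (f (chart \<Gamma> e (t + \<sigma> * h)) - f (chart \<Gamma> e t)) / h))"

definition ord_at :: "('a, 'e, 'z) graph_model_scheme \<Rightarrow> ('a \<Rightarrow> real) \<Rightarrow> 'a \<Rightarrow> real" where
  "ord_at \<Gamma> f p = (\<Sum>\<delta>\<in>directions \<Gamma> p. outgoing_slope \<Gamma> f \<delta>)"

lemma chart_unique_place:
  assumes "metric_graph \<Gamma>" "e \<in> edges \<Gamma>" "t \<in> {0<..<len \<Gamma> e}"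
    and "e' \<in> edges \<Gamma>" "t' \<in> {0..len \<Gamma> e'}" "chart \<Gamma> e' t' = chart \<Gamma> e t"
  shows "e' = e \<and> t' = t"
proof -
  have nv: "chart \<Gamma> e t \<notin> verts \<Gamma>"
    and ends: "chart \<Gamma> e' 0 \<in> verts \<Gamma>" "chart \<Gamma> e' (len \<Gamma> e') \<in> verts \<Gamma>"
    and inj: "inj_on (\<lambda>(e, t). chart \<Gamma> e t) (SIGMA e:edges \<Gamma>. {0<..<len \<Gamma> e})"
    using assms unfolding metric_graph_def by blast+
  have "t' \<noteq> 0" "t' \<noteq> len \<Gamma> e'"
    using nv ends assms(6) by auto
  then have "t' \<in> {0<..<len \<Gamma> e'}" using assms(5) by auto
  then have "(e', t') = (e, t)"
    using inj_onD[OF inj, of "(e', t')" "(e, t)"] assms by auto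
  then show ?thesis by simp
qed

lemma finite_directions:
  assumes "metric_graph \<Gamma>"
  shows "finite (directions \<Gamma> p)"
proof -
  have fin: "finite (edges \<Gamma>)" using assms by (simp add: metric_graph_def)
  have "finite {t \<in> {0..len \<Gamma> e}. chart \<Gamma> e t = p}" if e: "e \<in> edges \<Gamma>" for e
  proof (cases "\<exists>t\<in>{0<..<len \<Gamma> e}. chart \<Gamma> e t = p")
    case True
    then obtain u where "u \<in> {0<..<len \<Gamma> e}" "chart \<Gamma> e u = p" by blast
    then have "{t \<in> {0..len \<Gamma> e}. chart \<Gamma> e t = p} \<subseteq> {u}"
      using chart_unique_place[OF assms e _ e, of u] by auto
    then show ?thesis by (rule finite_subset) simp
  next
    case False
    then have "{t \<in> {0..len \<Gamma> e}. chart \<Gamma> e t = p} \<subseteq> {0, len \<Gamma> e}" by force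
    then show ?thesis by (rule finite_subset) simp
  qed
  then have "finite (SIGMA e:edges \<Gamma>. {t \<in> {0..len \<Gamma> e}. chart \<Gamma> e t = p} \<times> {1, -1 :: real})"
    using fin by (intro finite_SigmaI) auto
  moreover have "directions \<Gamma> p \<subseteq>
      (SIGMA e:edges \<Gamma>. {t \<in> {0..len \<Gamma> e}. chart \<Gamma> e t = p} \<times> {1, -1 :: real})"
    by (auto simp: directions_def)
  ultimately show ?thesis by (rule rev_finite_subset)
qed

lemma outgoing_slope_eq:
  assumes "0 < \<epsilon>" "\<And>h. h \<in> {0..<\<epsilon>} \<Longrightarrow> f (chart \<Gamma> e (t + \<sigma> * h)) = f (chart \<Gamma> e t) + c * h"
  shows "outgoing_slope \<Gamma> f (e, t, \<sigma>) = c"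
proof -
  have "\<forall>\<^sub>F h in at_right 0. (f (chart \<Gamma> e (t + \<sigma> * h)) - f (chart \<Gamma> e t)) / h = c"
    using eventually_at_right_real[OF assms(1)] by eventually_elim (use assms(2) in auto)
  then have "((\<lambda>h. (f (chart \<Gamma> e (t + \<sigma> * h)) - f (chart \<Gamma> e t)) / h) \<longlongrightarrow> c) (at_right 0)"
    by (rule tendsto_eventually)
  then have "Lim (at_right 0) (\<lambda>h. (f (chart \<Gamma> e (t + \<sigma> * h)) - f (chart \<Gamma> e t)) / h) = c"
    by (rule tendsto_Lim[rotated]) simp
  then show ?thesis
    unfolding outgoing_slope_def by simp
qed

text \<open>Only finitely many points have nonzero order, so sums over these points are not junk.\<close>

lemma finite_ord_nonzero:
  assumes "metric_graph \<Gamma>" "quasi_meromorphic \<Gamma> f"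
  shows "finite {x \<in> points \<Gamma>. ord_at \<Gamma> f x \<noteq> 0}"
proof -
  have "\<exists>T. finite T \<and> (\<forall>t\<in>{0..len \<Gamma> e} - T. ord_at \<Gamma> f (chart \<Gamma> e t) = 0)" if e: "e \<in> edges \<Gamma>" for e
  proof -
    obtain n \<tau> where \<tau>: "\<tau> 0 = 0" "\<tau> n = len \<Gamma> e"
      and lin: "\<And>i. i < n \<Longrightarrow> \<exists>a b. \<forall>t\<in>{\<tau> i..\<tau> (Suc i)}. f (chart \<Gamma> e t) = a * t + b"
      using assms(2) e unfolding quasi_meromorphic_def piecewise_linear_def by meson
    have "ord_at \<Gamma> f (chart \<Gamma> e t) = 0"
      if t: "t \<in> {0..len \<Gamma> e} - \<tau> ` {..n}" for t
    proof -
      have "0 \<in> \<tau> ` {..n}" "len \<Gamma> e \<in> \<tau> ` {..n}" using \<tau> by force+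
      then have t01: "t \<in> {0<..<len \<Gamma> e}" using t by (auto simp: order.order_iff_strict)
      have "\<exists>i<n. \<tau> i < t \<and> t < \<tau> (Suc i)"
      proof -
        define k where "k = (LEAST k. t < \<tau> k)"
        have tn: "t < \<tau> n" using t01 \<tau> by simp
        then have k1: "t < \<tau> k" "k \<le> n" unfolding k_def by (auto intro: LeastI Least_le)
        have "k \<noteq> 0" using k1 t01 \<tau> by (metis greaterThanLessThan_iff not_less_iff_gr_or_eq)
        then obtain i where i: "k = Suc i" using not0_implies_Suc by blast
        have "\<not> t < \<tau> i" using not_less_Least[of i "\<lambda>k. t < \<tau> k"] i k_def by simp
        moreover have "t \<noteq> \<tau> i" using t i k1 by auto
        ultimately show ?thesis using i k1 by (intro exI[of _ i]) auto
      qed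
      then obtain i where i: "i < n" "\<tau> i < t" "t < \<tau> (Suc i)" by blast
      obtain a b where ab: "\<And>s. s \<in> {\<tau> i..\<tau> (Suc i)} \<Longrightarrow> f (chart \<Gamma> e s) = a * s + b"
        using lin[OF i(1)] by blast
      define \<epsilon> where "\<epsilon> = min (t - \<tau> i) (\<tau> (Suc i) - t)"
      have \<epsilon>: "0 < \<epsilon>" using i by (simp add: \<epsilon>_def)
      have "outgoing_slope \<Gamma> f (e, t, 1) = a"
        by (rule outgoing_slope_eq[OF \<epsilon>]) (use i in \<open>simp add: ab \<epsilon>_def algebra_simps\<close>)
      moreover have "outgoing_slope \<Gamma> f (e, t, -1) = -a"
        by (rule outgoing_slope_eq[OF \<epsilon>]) (use i in \<open>simp add: ab \<epsilon>_def algebra_simps\<close>)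
      moreover have "directions \<Gamma> (chart \<Gamma> e t) = {(e, t, 1), (e, t, -1)}"
      proof (intro set_eqI iffI)
        fix \<delta> assume \<delta>: "\<delta> \<in> directions \<Gamma> (chart \<Gamma> e t)"
        obtain e' t' \<sigma> where d: "\<delta> = (e', t', \<sigma>)" by (metis prod_cases3)
        with \<delta> have "e' = e \<and> t' = t"
          using chart_unique_place[OF assms(1) e t01, of e' t'] by (simp add: directions_def)
        with \<delta> d show "\<delta> \<in> {(e, t, 1), (e, t, -1)}" by (auto simp: directions_def)
      qed (use e t01 in \<open>auto simp: directions_def\<close>)
      ultimately show ?thesis using t01 by (simp add: ord_at_def)
    qed
    then show ?thesis by (intro exI[of _ "\<tau> ` {..n}"]) auto
  qed
  then obtain T where T: "\<And>e. e \<in> edges \<Gamma> \<Longrightarrow> finite (T e)"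
    "\<And>e t. \<lbrakk>e \<in> edges \<Gamma>; t \<in> {0..len \<Gamma> e} - T e\<rbrakk> \<Longrightarrow> ord_at \<Gamma> f (chart \<Gamma> e t) = 0"
    by (metis (no_types, lifting))
  have "{x \<in> points \<Gamma>. ord_at \<Gamma> f x \<noteq> 0} \<subseteq> verts \<Gamma> \<union> (\<Union>e\<in>edges \<Gamma>. chart \<Gamma> e ` T e)"
  proof
    fix x assume x: "x \<in> {x \<in> points \<Gamma>. ord_at \<Gamma> f x \<noteq> 0}"
    have "points \<Gamma> = verts \<Gamma> \<union> (\<Union>e\<in>edges \<Gamma>. chart \<Gamma> e ` {0..len \<Gamma> e})"
      using assms(1) by (simp add: metric_graph_def)
    with x consider "x \<in> verts \<Gamma>" | e t where "e \<in> edges \<Gamma>" "t \<in> {0..len \<Gamma> e}" "x = chart \<Gamma> e t"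
      by auto
    then show "x \<in> verts \<Gamma> \<union> (\<Union>e\<in>edges \<Gamma>. chart \<Gamma> e ` T e)"
    proof cases
      case 2
      then have "t \<in> T e" using T(2)[of e t] x by auto
      with 2 show ?thesis by blast
    qed blast
  qed
  moreover have "finite (verts \<Gamma> \<union> (\<Union>e\<in>edges \<Gamma>. chart \<Gamma> e ` T e))"
    using assms(1) T(1) unfolding metric_graph_def by auto
  ultimately show ?thesis by (rule finite_subset)
qed

end

theory Submission
  imports Defs
begin

text \<open>
  Subdivide every edge at the break points of both functions.  Grouping the two outgoing directions
  at the ends of a piece of length \<open>d\<close> on which the functions have slopes \<open>a\<close> and \<open>c\<close>, that piece
  contributes \<open>- a * c * d\<close> to either side.
\<close>

definition affine_on :: "real set \<Rightarrow> (real \<Rightarrow> real) \<Rightarrow> bool" where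
  "affine_on S h \<longleftrightarrow> (\<exists>a b. \<forall>t\<in>S. h t = a * t + b)"

text \<open>The single-edge counterpart of \<open>directions\<close>, with the edge name dropped and
  \<open>t\<close> restricted to \<open>T\<close>. It turns the sum over one edge into a matter of
  finite subsets of an interval.\<close>

definition edge_directions :: "real \<Rightarrow> real set \<Rightarrow> (real \<times> real) set" where
  "edge_directions L T = {(t, \<sigma>). t \<in> T \<and> (\<sigma> = 1 \<and> t < L \<or> \<sigma> = -1 \<and> 0 < t)}"

text \<open>\<open>T\<close> collects the break points of a witnessing partition. Speaking of all
  intervals whose interior avoids \<open>T\<close> makes the property survive enlarging
  \<open>T\<close>, so the breaks of two functions can later be merged.\<close>

lemma piecewise_linear_affine_between_breaks:
  assumes "piecewise_linear L h"
  obtains T where "finite T"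
    "\<And>s t. \<lbrakk>0 \<le> s; s < t; t \<le> L; {s<..<t} \<inter> T = {}\<rbrakk> \<Longrightarrow> affine_on {s..t} h"
proof -
  obtain n \<tau> where \<tau>: "\<tau> 0 = 0" "\<tau> n = L"
    and lin: "\<And>i. i < n \<Longrightarrow> affine_on {\<tau> i..\<tau> (Suc i)} h"
    using assms unfolding piecewise_linear_def affine_on_def[symmetric] by blast
  have "affine_on {s..t} h"
    if st: "0 \<le> s" "s < t" "t \<le> L" "{s<..<t} \<inter> \<tau> ` {..n} = {}" for s t
  proof -
    \<comment> \<open>The first break point at or beyond \<open>t\<close> closes the piece sought.
      By minimality its predecessor lies before \<open>t\<close>, and since it is not inside
      \<open>{s<..<t}\<close> it is at most \<open>s\<close>.\<close>
    define k where "k = (LEAST k. t \<le> \<tau> k)"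
    have "t \<le> \<tau> n" using st \<tau> by simp
    then have k: "t \<le> \<tau> k" "k \<le> n" unfolding k_def by (auto intro: LeastI Least_le)
    have "k \<noteq> 0" using k st \<tau> by (metis leD order_le_less_trans)
    then obtain i where i: "k = Suc i" using not0_implies_Suc by blast
    have "\<not> t \<le> \<tau> i" using not_less_Least[of i "\<lambda>k. t \<le> \<tau> k"] i k_def by simp
    moreover have "\<tau> i \<notin> {s<..<t}" using st(4) i k by auto
    ultimately have "{s..t} \<subseteq> {\<tau> i..\<tau> (Suc i)}" using k i by auto
    with lin[of i] k i show ?thesis unfolding affine_on_def by (meson Suc_le_lessD subsetD)
  qed
  then show ?thesis using that[of "\<tau> ` {..n}"] by blast
qed

lemma finite_set_increasing_enumeration:
  fixes T :: "real set"
  assumes "finite T" "T \<subseteq> {0..L}" "0 \<in> T" "L \<in> T"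
  obtains n \<tau> where "T = \<tau> ` {..n}" "strict_mono_on {..n} \<tau>" "\<tau> 0 = 0" "\<tau> n = L"
    "\<And>i. i < n \<Longrightarrow> {\<tau> i<..<\<tau> (Suc i)} \<inter> T = {}"
proof -
  \<comment> \<open>\<open>n\<close> counts the gaps between neighbouring points. As
    \<open>T\<close> is nonempty, the natural subtraction does not truncate.\<close>
  define n where "n = card T - 1"
  define \<tau> where "\<tau> = (!) (sorted_list_of_set T)"
  have "card T > 0" using assms by (auto simp: card_gt_0_iff)
  then have len: "length (sorted_list_of_set T) = Suc n" by (simp add: n_def)
  have T: "T = \<tau> ` {..n}"
    using nth_image[of "Suc n" "sorted_list_of_set T"] len assms(1)
    by (simp add: \<tau>_def lessThan_Suc_atMost atLeast0LessThan)
  have mono: "strict_mono_on {..n} \<tau>"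
    using sorted_wrt_nth_less[OF strict_sorted_list_of_set[of T]] len
    by (auto simp: strict_mono_on_def \<tau>_def)
  then have le: "\<tau> i \<le> \<tau> j" if "i \<le> j" "j \<le> n" for i j
    using strict_mono_on_leD[OF mono, of i j] that by auto
  obtain i j where "i \<le> n" "\<tau> i = 0" "j \<le> n" "\<tau> j = L"
    using assms(3,4) T by (metis atMost_iff imageE)
  moreover have "\<tau> 0 \<in> {0..L}" "\<tau> n \<in> {0..L}" using assms(2) T by auto
  ultimately have "\<tau> 0 = 0" "\<tau> n = L"
    using le[of 0 i] le[of j n] by auto
  moreover have "{\<tau> i<..<\<tau> (Suc i)} \<inter> T = {}" if "i < n" for i
  proof -
    have "\<tau> j \<notin> {\<tau> i<..<\<tau> (Suc i)}" if "j \<le> n" for j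
      using le[of j i] le[of "Suc i" j] that \<open>i < n\<close> by (cases "j \<le> i") auto
    then show ?thesis unfolding T by auto
  qed
  ultimately show ?thesis using that T mono by blast
qed

text \<open>Entering the piece from its left end follows the parameter, entering it from its right
  end reverses it; hence the opposite signs.\<close>

lemma outgoing_slopes_of_affine_piece:
  assumes "s < t" "\<And>u. u \<in> {s..t} \<Longrightarrow> f (chart \<Gamma> e u) = a * u + b"
  shows "outgoing_slope \<Gamma> f (e, s, 1) = a" "outgoing_slope \<Gamma> f (e, t, -1) = -a"
proof -
  have pos: "0 < t - s" using assms(1) by simp
  show "outgoing_slope \<Gamma> f (e, s, 1) = a" "outgoing_slope \<Gamma> f (e, t, -1) = -a"
    by (rule outgoing_slope_eq[OF pos], use assms in \<open>simp add: algebra_simps\<close>)+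
qed

text \<open>Regroups directions by piece instead of by point: every direction points into exactly
  one piece, and every piece is entered once from each end. The two directions at an interior point
  go to neighbouring pieces.\<close>

lemma sum_edge_directions:
  fixes F :: "real \<times> real \<Rightarrow> 'b::comm_monoid_add"
  assumes T: "T = \<tau> ` {..n}" and mono: "strict_mono_on {..n} \<tau>" and ends: "\<tau> 0 = 0" "\<tau> n = L"
  shows "sum F (edge_directions L T) = (\<Sum>i<n. F (\<tau> i, 1) + F (\<tau> (Suc i), -1))"
proof -
  have inj: "inj_on \<tau> {..n}"
    using mono by (rule strict_mono_on_imp_inj_on)
  have lt: "\<tau> i < L \<longleftrightarrow> i < n" "0 < \<tau> i \<longleftrightarrow> i \<noteq> 0" if "i \<le> n" for i
    using strict_mono_onD[OF mono, of i n] strict_mono_onD[OF mono, of 0 i] that ends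
    by (cases "i = n"; cases "i = 0"; simp)+
  let ?R = "(\<lambda>i. (\<tau> i, 1 :: real)) ` {..<n}" and ?L = "(\<lambda>i. (\<tau> (Suc i), -1 :: real)) ` {..<n}"
  have "edge_directions L T = ?R \<union> ?L"
  proof (intro set_eqI iffI)
    fix d assume "d \<in> edge_directions L T"
    then obtain i \<sigma> where i: "i \<le> n" "d = (\<tau> i, \<sigma>)"
      and "\<sigma> = 1 \<and> \<tau> i < L \<or> \<sigma> = -1 \<and> 0 < \<tau> i"
      unfolding edge_directions_def T by auto
    then consider "i < n" "\<sigma> = 1" | j where "i = Suc j" "\<sigma> = -1"
      using lt[OF i(1)] not0_implies_Suc by blast
    then show "d \<in> ?R \<union> ?L" using i by cases auto
  next
    fix d assume "d \<in> ?R \<union> ?L"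
    then show "d \<in> edge_directions L T"
      using lt unfolding edge_directions_def T by fastforce
  qed
  moreover have "inj_on (\<lambda>i. (\<tau> i, 1 :: real)) {..<n}" "inj_on (\<lambda>i. (\<tau> (Suc i), -1 :: real)) {..<n}"
    using inj by (force simp: inj_on_def)+
  moreover have "?R \<inter> ?L = {}" by auto
  ultimately show ?thesis
    by (simp add: sum.union_disjoint sum.reindex sum.distrib)
qed

lemma edge_sum_symmetric:
  assumes "finite T" "T \<subseteq> {0..L}" "0 \<in> T" "L \<in> T"
    and f: "\<And>s t. \<lbrakk>0 \<le> s; s < t; t \<le> L; {s<..<t} \<inter> T = {}\<rbrakk> \<Longrightarrow> affine_on {s..t} (\<lambda>u. f (chart \<Gamma> e u))"
    and g: "\<And>s t. \<lbrakk>0 \<le> s; s < t; t \<le> L; {s<..<t} \<inter> T = {}\<rbrakk> \<Longrightarrow> affine_on {s..t} (\<lambda>u. g (chart \<Gamma> e u))"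
  shows "(\<Sum>(t, \<sigma>)\<in>edge_directions L T. f (chart \<Gamma> e t) * outgoing_slope \<Gamma> g (e, t, \<sigma>)) =
         (\<Sum>(t, \<sigma>)\<in>edge_directions L T. g (chart \<Gamma> e t) * outgoing_slope \<Gamma> f (e, t, \<sigma>))"
proof -
  obtain n \<tau> where \<tau>: "T = \<tau> ` {..n}" "strict_mono_on {..n} \<tau>" "\<tau> 0 = 0" "\<tau> n = L"
    and gap: "\<And>i. i < n \<Longrightarrow> {\<tau> i<..<\<tau> (Suc i)} \<inter> T = {}"
    using finite_set_increasing_enumeration[OF assms(1-4)] by metis
  have "f (chart \<Gamma> e (\<tau> i)) * outgoing_slope \<Gamma> g (e, \<tau> i, 1) +
        f (chart \<Gamma> e (\<tau> (Suc i))) * outgoing_slope \<Gamma> g (e, \<tau> (Suc i), -1) =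
        g (chart \<Gamma> e (\<tau> i)) * outgoing_slope \<Gamma> f (e, \<tau> i, 1) +
        g (chart \<Gamma> e (\<tau> (Suc i))) * outgoing_slope \<Gamma> f (e, \<tau> (Suc i), -1)" if i: "i < n" for i
  proof -
    have lt: "\<tau> i < \<tau> (Suc i)" using strict_mono_onD[OF \<tau>(2), of i "Suc i"] i by simp
    have "\<tau> i \<in> T" "\<tau> (Suc i) \<in> T" using \<tau>(1) i by auto
    then have bd: "0 \<le> \<tau> i" "\<tau> (Suc i) \<le> L" using assms(2) by auto
    obtain a b where ab: "\<And>u. u \<in> {\<tau> i..\<tau> (Suc i)} \<Longrightarrow> f (chart \<Gamma> e u) = a * u + b"
      using f[OF bd(1) lt bd(2) gap[OF i]] unfolding affine_on_def by blast
    obtain c d where cd: "\<And>u. u \<in> {\<tau> i..\<tau> (Suc i)} \<Longrightarrow> g (chart \<Gamma> e u) = c * u + d"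
      using g[OF bd(1) lt bd(2) gap[OF i]] unfolding affine_on_def by blast
    have slopes: "outgoing_slope \<Gamma> f (e, \<tau> i, 1) = a" "outgoing_slope \<Gamma> f (e, \<tau> (Suc i), -1) = -a"
      "outgoing_slope \<Gamma> g (e, \<tau> i, 1) = c" "outgoing_slope \<Gamma> g (e, \<tau> (Suc i), -1) = -c"
      by (rule outgoing_slopes_of_affine_piece[OF lt], erule ab cd)+
    \<comment> \<open>Both sides equal \<open>a * c * (\<tau> i - \<tau> (Suc i))\<close>: the
      constants \<open>b\<close> and \<open>d\<close> cancel because the two slopes at the ends are
      opposite.\<close>
    show ?thesis
      using lt by (simp add: slopes ab cd algebra_simps)
  qed
  then show ?thesis
    unfolding sum_edge_directions[OF \<tau>] by (auto intro!: sum.cong)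
qed

text \<open>Double counting: a direction has one base point and lies on one edge, so the same finite
  set of triples can be sliced either way. Loops and multiple edges need no separate treatment,
  since a direction records its place on its edge.\<close>

lemma sum_ord_over_edges:
  assumes \<Gamma>: "metric_graph \<Gamma>" and P: "finite P"
  shows "(\<Sum>x\<in>P. f x * ord_at \<Gamma> g x) =
    (\<Sum>e\<in>edges \<Gamma>. \<Sum>(t, \<sigma>)\<in>edge_directions (len \<Gamma> e) {t \<in> {0..len \<Gamma> e}. chart \<Gamma> e t \<in> P}.
       f (chart \<Gamma> e t) * outgoing_slope \<Gamma> g (e, t, \<sigma>))"
    (is "_ = (\<Sum>e\<in>_. sum _ (?D e))")
proof -
  have U: "(\<Union>x\<in>P. directions \<Gamma> x) = (SIGMA e:edges \<Gamma>. ?D e)"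
    by (auto simp: directions_def edge_directions_def)
  have fin: "finite (SIGMA e:edges \<Gamma>. ?D e)"
    unfolding U[symmetric] using P finite_directions[OF \<Gamma>] by blast
  have finD: "finite (?D e)" if "e \<in> edges \<Gamma>" for e
    by (rule finite_subset[OF _ finite_imageI[OF fin, of snd]]) (use that in force)
  have finE: "finite (edges \<Gamma>)" using \<Gamma> by (simp add: metric_graph_def)
  let ?F = "\<lambda>(e, t, \<sigma>). f (chart \<Gamma> e t) * outgoing_slope \<Gamma> g (e, t, \<sigma>)"
  \<comment> \<open>For a direction at \<open>x\<close> the place \<open>chart \<Gamma> e t\<close>
    is \<open>x\<close> itself, so the factor \<open>f x\<close> can be written in terms of the
    direction alone.\<close>
  have "(\<Sum>x\<in>P. f x * ord_at \<Gamma> g x) = (\<Sum>x\<in>P. sum ?F (directions \<Gamma> x))"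
    unfolding ord_at_def sum_distrib_left
    by (intro sum.cong HOL.refl) (auto simp: directions_def)
  also have "\<dots> = sum ?F (\<Union>x\<in>P. directions \<Gamma> x)"
    by (rule sum.UNION_disjoint[symmetric])
       (use P finite_directions[OF \<Gamma>] in \<open>auto simp: directions_def\<close>)
  also have "\<dots> = (\<Sum>e\<in>edges \<Gamma>. \<Sum>d\<in>?D e. ?F (e, d))"
    unfolding U using sum.Sigma[of "edges \<Gamma>" ?D "\<lambda>e d. ?F (e, d)"] finE finD
    by (simp add: case_prod_unfold)
  finally show ?thesis by (simp add: case_prod_unfold)
qed

text \<open>On an edge of positive length every parameter is the start of some direction (forwards
  at 0, backwards elsewhere), so finiteness is inherited from \<open>directions\<close>.\<close>

lemma finite_places:
  assumes \<Gamma>: "metric_graph \<Gamma>" and P: "finite P" and e: "e \<in> edges \<Gamma>"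
  shows "finite {t \<in> {0..len \<Gamma> e}. chart \<Gamma> e t \<in> P}"
proof (rule finite_subset)
  have "0 < len \<Gamma> e" using \<Gamma> e by (simp add: metric_graph_def)
  then have "t \<in> (\<lambda>(e, t, \<sigma>). t) ` directions \<Gamma> (chart \<Gamma> e t)" if "t \<in> {0..len \<Gamma> e}" for t
    using that e by (cases "t = 0") (force simp: directions_def)+
  then show "{t \<in> {0..len \<Gamma> e}. chart \<Gamma> e t \<in> P} \<subseteq> (\<lambda>(e, t, \<sigma>). t) ` (\<Union>x\<in>P. directions \<Gamma> x)"
    unfolding image_UN by blast
  show "finite ((\<lambda>(e, t, \<sigma>). t) ` (\<Union>x\<in>P. directions \<Gamma> x))"
    using P finite_directions[OF \<Gamma>] by blast
qed

theorem mainTheorem2: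
  fixes \<Gamma> :: "('a, 'e) graph_model" and f g :: "'a \<Rightarrow> real"
  assumes "tropical_curve \<Gamma>"
    and "quasi_meromorphic \<Gamma> f" and "quasi_meromorphic \<Gamma> g"
  shows "(\<Sum>x\<in>{x \<in> points \<Gamma>. ord_at \<Gamma> g x \<noteq> 0}. f x * ord_at \<Gamma> g x) =
         (\<Sum>x\<in>{x \<in> points \<Gamma>. ord_at \<Gamma> f x \<noteq> 0}. g x * ord_at \<Gamma> f x)"
proof -
  have \<Gamma>: "metric_graph \<Gamma>" using assms(1) by (simp add: tropical_curve_def)
  \<comment> \<open>Stated for arbitrary \<open>h\<close> and \<open>e\<close> so that a single
    choice function \<open>B\<close> supplies the breaks of both \<open>f\<close> and
    \<open>g\<close> on all edges.\<close>
  have "\<exists>T. finite T \<and> (\<forall>s t. 0 \<le> s \<longrightarrow> s < t \<longrightarrow> t \<le> len \<Gamma> e \<longrightarrow> {s<..<t} \<inter> T = {} \<longrightarrow>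
          affine_on {s..t} (\<lambda>u. h (chart \<Gamma> e u)))"
    if "quasi_meromorphic \<Gamma> h" "e \<in> edges \<Gamma>" for h e
  proof -
    have "piecewise_linear (len \<Gamma> e) (\<lambda>u. h (chart \<Gamma> e u))"
      using that by (simp add: quasi_meromorphic_def)
    then show ?thesis by (rule piecewise_linear_affine_between_breaks) blast
  qed
  then obtain B where finB: "\<And>h e. \<lbrakk>quasi_meromorphic \<Gamma> h; e \<in> edges \<Gamma>\<rbrakk> \<Longrightarrow> finite (B h e)"
    and B: "\<And>h e s t. \<lbrakk>quasi_meromorphic \<Gamma> h; e \<in> edges \<Gamma>; 0 \<le> s; s < t; t \<le> len \<Gamma> e;
              {s<..<t} \<inter> B h e = {}\<rbrakk> \<Longrightarrow> affine_on {s..t} (\<lambda>u. h (chart \<Gamma> e u))"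
    by metis
  \<comment> \<open>One finite set for both sides: the vertices put the ends of each edge into
    \<open>T e\<close>, the breaks make both functions affine in between, and the two supports allow
    both sums to be extended to \<open>P\<close>.\<close>
  define P where "P = verts \<Gamma> \<union> (\<Union>e\<in>edges \<Gamma>. chart \<Gamma> e ` ((B f e \<union> B g e) \<inter> {0..len \<Gamma> e})) \<union>
    {x \<in> points \<Gamma>. ord_at \<Gamma> f x \<noteq> 0} \<union> {x \<in> points \<Gamma>. ord_at \<Gamma> g x \<noteq> 0}"
  \<comment> \<open>All places over \<open>P\<close> are taken, not only the breaks on
    \<open>e\<close>, to match the index set in \<open>sum_ord_over_edges\<close>.\<close>
  define T where "T e = {t \<in> {0..len \<Gamma> e}. chart \<Gamma> e t \<in> P}" for e
  have finP: "finite P"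
    using \<Gamma> finB assms finite_ord_nonzero[OF \<Gamma>] by (auto simp: P_def metric_graph_def)
  have "points \<Gamma> = verts \<Gamma> \<union> (\<Union>e\<in>edges \<Gamma>. chart \<Gamma> e ` {0..len \<Gamma> e})"
    using \<Gamma> by (simp add: metric_graph_def)
  then have subP: "P \<subseteq> points \<Gamma>"
    unfolding P_def by blast
  \<comment> \<open>The points added to the support have order zero and contribute nothing.\<close>
  have to_P: "(\<Sum>x\<in>{x \<in> points \<Gamma>. ord_at \<Gamma> h x \<noteq> 0}. k x * ord_at \<Gamma> h x) =
      (\<Sum>x\<in>P. k x * ord_at \<Gamma> h x)" if "h \<in> {f, g}" for h k
    using that subP by (intro sum.mono_neutral_left finP) (auto simp: P_def)
  have "(\<Sum>(t, \<sigma>)\<in>edge_directions (len \<Gamma> e) (T e). f (chart \<Gamma> e t) * outgoing_slope \<Gamma> g (e, t, \<sigma>)) =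
        (\<Sum>(t, \<sigma>)\<in>edge_directions (len \<Gamma> e) (T e). g (chart \<Gamma> e t) * outgoing_slope \<Gamma> f (e, t, \<sigma>))"
    if e: "e \<in> edges \<Gamma>" for e
  proof (rule edge_sum_symmetric)
    have "0 < len \<Gamma> e" "chart \<Gamma> e 0 \<in> P" "chart \<Gamma> e (len \<Gamma> e) \<in> P"
      using \<Gamma> e by (auto simp: metric_graph_def P_def)
    then show "0 \<in> T e" "len \<Gamma> e \<in> T e" by (auto simp: T_def)
    show "finite (T e)" unfolding T_def by (rule finite_places[OF \<Gamma> finP e])
    show "T e \<subseteq> {0..len \<Gamma> e}" by (auto simp: T_def)
    have "(B f e \<union> B g e) \<inter> {0..len \<Gamma> e} \<subseteq> T e" using e by (auto simp: T_def P_def)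
    then have gap: "{s<..<t} \<inter> B f e = {}" "{s<..<t} \<inter> B g e = {}"
      if "0 \<le> s" "t \<le> len \<Gamma> e" "{s<..<t} \<inter> T e = {}" for s t
      using that by fastforce+
    show "affine_on {s..t} (\<lambda>u. f (chart \<Gamma> e u))" "affine_on {s..t} (\<lambda>u. g (chart \<Gamma> e u))"
      if "0 \<le> s" "s < t" "t \<le> len \<Gamma> e" "{s<..<t} \<inter> T e = {}" for s t
      using B[OF assms(2) e] B[OF assms(3) e] gap that by blast+
  qed
  then have "(\<Sum>x\<in>P. f x * ord_at \<Gamma> g x) = (\<Sum>x\<in>P. g x * ord_at \<Gamma> f x)"
    unfolding sum_ord_over_edges[OF \<Gamma> finP] T_def by (rule sum.cong[OF HOL.refl])
  then show ?thesis by (simp add: to_P)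
qed

end
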